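(* Let $\mu,\omega:\mathbb{Z}\to\mathbb{R}^+$ be growth rates such that $\mu$ is weakly faster than $\omega$, and fix $a,b\in\mathbb{R}\cup\{\pm\infty\}$ with $a\le0\le b$. Then, for the system $x(k+1)=A(k)x(k)$, $k\in\mathbb{Z}$: (i) if $\Sigma^+_{\omega\mathrm{D}}(A)\subset[0,b]$, then $\Sigma^+_{\mu\mathrm{D}}(A)\subset[0,b]$; (ii) if $\Sigma^-_{\omega\mathrm{D}}(A)\subset[a,0]$, then $\Sigma^-_{\mu\mathrm{D}}(A)\subset[a,0]$; (iii) if $\Sigma_{\omega\mathrm{D}}(A)\subset[a,b]$, then $\Sigma_{\mu\mathrm{D}}(A)\subset[a,b]$.
   Context: System: $A:\mathbb{Z}\to GL_d(\mathbb{R})$, and $x(k+1)=A(k)x(k)$, $k\in\mathbb{Z}$. Its evolution operator is $\Phi(k,n)=A(k-1)\cdots A(n)$ for $k>n$, $\Phi(n,n)=\mathrm{Id}$, $\Phi(k,n)=A^{-1}(k)\cdots A^{-1}(n-1)$ for $k<n$. Growth rate: a non-decreasing map $\mu:\mathbb{Z}\to\mathbb{R}^+=(0,\infty)$ with $\mu(0)=1$, $\lim_{n\to+\infty}\mu(n)=+\infty$, $\lim_{n\to-\infty}\mu(n)=0$. Weakly faster: $\mu$ is weakly faster than $\omega$ if for every $\alpha<0$ there is $M\ge1$ such that $\left(\frac{\mu(k)}{\mu(n)}\right)^{\alpha}\le M\left(\frac{\omega(k)}{\omega(n)}\right)^{\alpha}$ for all integers $k\ge n$. Invariant projector: a map $n\mapsto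 \mathrm{P}(n)$ of idempotent $d\times d$ matrices with $A(k)\mathrm{P}(k)=\mathrm{P}(k+1)A(k)$ for all $k\in\mathbb{Z}$. $\mu$-dichotomy ($\mu$D): there are an invariant projector $\mathrm{P}$ and constants $K\ge1$, $\alpha<0$, $\beta>0$ with $\|\Phi(k,n)\mathrm{P}(n)\|\le K\left(\frac{\mu(k)}{\mu(n)}\right)^{\alpha}$ for all $k\ge n$ and $\|\Phi(k,n)[\mathrm{Id}-\mathrm{P}(n)]\|\le K\left(\frac{\mu(k)}{\mu(n)}\right)^{\beta}$ for all $k\le n$. Weighted system: for $\gamma\in\mathbb{R}$ the $(\mu,\gamma)$-weighted system is $x(k+1)=A(k)\left(\frac{\mu(k+1)}{\mu(k)}\right)^{-\gamma}x(k)$. By convention, the weighted system for $\gamma=+\infty$ admits $\mu$D if there is $\hat\gamma\in\mathbb{R}$ such that the $(\mu,\hat\gamma)$-weighted system admits $\mu$D with projector $\mathrm{P}\equiv\mathrm{Id}$; for $\gamma=-\infty$ it admits $\mu$D if there is $\hat\gamma\in\mathbb{R}$ such that the $(\mu,\hat\gamma)$-weighted system admits $\mu$D with projector $\mathrm{P}\equiv0$. Spectrum: $\Sigma_{\mu\mathrm{D}}(A)=\{\gamma\in\mathbb{R}\cup\{\pm\infty\}:\text{the }(\mu,\gamma)\text{-weighted system does not admit }\mu\mathrm{D}\}$; $\Sigma^+_{\mu\mathrm{D}}(A)=\Sigma_{\mu\mathrm{D}}(A)\cap[0,+\infty]$ and $\Sigma^-_{\mu\mathrm{D}}(A)=\Sigma_{\mu\mathrm{D}}(A)\cap[-\infty,0]$;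 likewise with $\omega$ in place of $\mu$. Intervals are closed intervals of the extended real line $\mathbb{R}\cup\{\pm\infty\}$. *)

theory Defs
  imports "HOL-Analysis.Analysis"
begin

text \<open>Linear nonautonomous difference equations x(k+1) = A(k) x(k), k an integer, on a
  finite-dimensional real space; the matrix norm is the operator norm induced by the Euclidean
  norm (all matrix norms being equivalent, another choice only changes the constant K below).\<close>

primrec evol_fwd :: "(int \<Rightarrow> real^'n^'n) \<Rightarrow> int \<Rightarrow> nat \<Rightarrow> real^'n^'n" where
  "evol_fwd A n 0 = mat 1"
| "evol_fwd A n (Suc j) = A (n + int j) ** evol_fwd A n j"

primrec evol_bwd :: "(int \<Rightarrow> real^'n^'n) \<Rightarrow> int \<Rightarrow> nat \<Rightarrow> real^'n^'n" where
  "evol_bwd A n 0 = mat 1"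
| "evol_bwd A n (Suc j) = matrix_inv (A (n - int (Suc j))) ** evol_bwd A n j"

text \<open>The evolution operator: A(k-1) ... A(n) for k > n, the identity for k = n, and
  A(k)^{-1} ... A(n-1)^{-1} for k < n.\<close>

definition evolution :: "(int \<Rightarrow> real^'n^'n) \<Rightarrow> int \<Rightarrow> int \<Rightarrow> real^'n^'n" where
  "evolution A k n =
     (if n \<le> k then evol_fwd A n (nat (k - n)) else evol_bwd A n (nat (n - k)))"

definition growth_rate :: "(int \<Rightarrow> real) \<Rightarrow> bool" where
  "growth_rate \<mu> \<longleftrightarrow>
     (\<forall>n. 0 < \<mu> n) \<and> mono \<mu> \<and> \<mu> 0 = 1 \<and>
     filterlim \<mu> at_top at_top \<and> (\<mu> \<longlongrightarrow> 0) at_bot"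

definition weakly_faster :: "(int \<Rightarrow> real) \<Rightarrow> (int \<Rightarrow> real) \<Rightarrow> bool" where
  "weakly_faster \<mu> \<omega> \<longleftrightarrow>
     (\<forall>\<alpha><0. \<exists>M\<ge>1. \<forall>k n. n \<le> k \<longrightarrow>
        (\<mu> k / \<mu> n) powr \<alpha> \<le> M * (\<omega> k / \<omega> n) powr \<alpha>)"

definition invariant_projector ::
  "(int \<Rightarrow> real^'n^'n) \<Rightarrow> (int \<Rightarrow> real^'n^'n) \<Rightarrow> bool" where
  "invariant_projector A P \<longleftrightarrow>
     (\<forall>n. P n ** P n = P n) \<and> (\<forall>k. A k ** P k = P (k + 1) ** A k)"

definition dichotomy_with ::
  "(int \<Rightarrow> real) \<Rightarrow> (int \<Rightarrow> real^'n^'n) \<Rightarrow> (int \<Rightarrow> real^'n^'n) \<Rightarrow> bool" where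
  "dichotomy_with \<mu> A P \<longleftrightarrow>
     invariant_projector A P \<and>
     (\<exists>K \<alpha> \<beta>. 1 \<le> K \<and> \<alpha> < 0 \<and> 0 < \<beta> \<and>
        (\<forall>k n. n \<le> k \<longrightarrow>
           onorm ((*v) (evolution A k n ** P n)) \<le> K * (\<mu> k / \<mu> n) powr \<alpha>) \<and>
        (\<forall>k n. k \<le> n \<longrightarrow>
           onorm ((*v) (evolution A k n ** (mat 1 - P n))) \<le> K * (\<mu> k / \<mu> n) powr \<beta>))"

definition dichotomy :: "(int \<Rightarrow> real) \<Rightarrow> (int \<Rightarrow> real^'n^'n) \<Rightarrow> bool" where
  "dichotomy \<mu> A \<longleftrightarrow> (\<exists>P. dichotomy_with \<mu> A P)"

definition weighted ::
  "(int \<Rightarrow> real) \<Rightarrow> real \<Rightarrow> (int \<Rightarrow> real^'n^'n) \<Rightarrow> int \<Rightarrow> real^'n^'n" where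
  "weighted \<mu> \<gamma> A k = ((\<mu> (k + 1) / \<mu> k) powr (- \<gamma>)) *\<^sub>R A k"

text \<open>At \<open>\<gamma> = \<plusminus>\<infinity>\<close> there is no weighted system; admitting a dichotomy is a convention there.\<close>

fun weighted_dichotomy :: "(int \<Rightarrow> real) \<Rightarrow> (int \<Rightarrow> real^'n^'n) \<Rightarrow> ereal \<Rightarrow> bool" where
  "weighted_dichotomy \<mu> A (ereal \<gamma>) = dichotomy \<mu> (weighted \<mu> \<gamma> A)"
| "weighted_dichotomy \<mu> A PInfty = (\<exists>\<gamma>. dichotomy_with \<mu> (weighted \<mu> \<gamma> A) (\<lambda>_. mat 1))"
| "weighted_dichotomy \<mu> A MInfty = (\<exists>\<gamma>. dichotomy_with \<mu> (weighted \<mu> \<gamma> A) (\<lambda>_. 0))"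

definition spectrum :: "(int \<Rightarrow> real) \<Rightarrow> (int \<Rightarrow> real^'n^'n) \<Rightarrow> ereal set" where
  "spectrum \<mu> A = {\<gamma>. \<not> weighted_dichotomy \<mu> A \<gamma>}"

definition spectrum_pos :: "(int \<Rightarrow> real) \<Rightarrow> (int \<Rightarrow> real^'n^'n) \<Rightarrow> ereal set" where
  "spectrum_pos \<mu> A = spectrum \<mu> A \<inter> {0..\<infinity>}"

definition spectrum_neg :: "(int \<Rightarrow> real) \<Rightarrow> (int \<Rightarrow> real^'n^'n) \<Rightarrow> ereal set" where
  "spectrum_neg \<mu> A = spectrum \<mu> A \<inter> {-\<infinity>..0}"

end

theory Submission
  imports Defs
begin

text \<open>A weighted dichotomy whose projector is the identity is nothing but a growth bound: writing
  \<open>\<Phi>\<close> for the evolution operator, it says that \<open>\<parallel>\<Phi>(k,n)\<parallel> \<le> K (\<omega>(k)/\<omega>(n))\<^sup>c\<close> for \<open>k \<ge> n\<close> with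
  some exponent \<open>c < \<gamma>\<close> (\<open>dichotomy_with_id_iff\<close>). Call such a \<open>c\<close> a forward exponent.
  Dually, the projector zero at weight \<open>\<gamma>\<close> means a backward exponent \<open>d > \<gamma>\<close>, a bound of the same
  form for \<open>k \<le> n\<close>. Two facts about these exponents give the theorem.

  First, if the whole ray to the right of \<open>b\<close>, including \<open>+\<infinity>\<close>, avoids the spectrum, then at each
  of its finite points there is a dichotomy whose projector is the identity
  (\<open>dichotomy_id_right_of_spectrum\<close>). The convention at \<open>+\<infinity>\<close> provides at least one forward exponent.
  If some \<open>\<gamma> > b\<close> had no forward exponent below it, the infimum \<open>s\<close> of all forward exponents would be
  at least \<open>\<gamma>\<close>, and there would be a dichotomy at \<open>s\<close>, with a projector \<open>P\<close>. Its complementary part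
  contracts backward in time at a rate strictly above \<open>s\<close>; but some forward exponent lies below that
  rate, so going from time \<open>n\<close> back to time \<open>k\<close> and returning shows that \<open>Id - P(n)\<close> is bounded by a
  quantity that tends to \<open>0\<close> as \<open>k \<rightarrow> -\<infinity>\<close>. Hence \<open>P = Id\<close>, and then there is a forward exponent
  smaller than \<open>s\<close>, a contradiction. This replaces the usual argument that the rank of the projector is
  constant on a connected piece of the resolvent set.

  Second, a positive forward exponent for \<open>\<omega>\<close> is one for every weakly faster \<open>\<mu>\<close>, since
  \<open>(\<omega>(k)/\<omega>(n))\<^sup>c \<le> M (\<mu>(k)/\<mu>(n))\<^sup>c\<close> for \<open>c > 0\<close> and \<open>k \<ge> n\<close>. Because \<open>b \<ge> 0\<close>, a forward exponent below
  \<open>\<gamma> > b\<close> may be raised to a positive one that is still below \<open>\<gamma>\<close>, so the dichotomy with identity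
  projector passes from \<open>\<omega>\<close> to \<open>\<mu>\<close> at every \<open>\<gamma> > b\<close>. The negative half of the spectrum is dual, and
  the statement on the full spectrum combines the two halves.\<close>

abbreviation opnorm :: "real^'n^'m \<Rightarrow> real" where
  "opnorm M \<equiv> onorm ((*v) M)"

definition forward_exponent ::
  "(int \<Rightarrow> real) \<Rightarrow> (int \<Rightarrow> real^'n^'n) \<Rightarrow> real \<Rightarrow> bool" where
  "forward_exponent \<omega> A c \<longleftrightarrow>
     (\<exists>K\<ge>1. \<forall>k n. n \<le> k \<longrightarrow> opnorm (evolution A k n) \<le> K * (\<omega> k / \<omega> n) powr c)"

definition backward_exponent ::
  "(int \<Rightarrow> real) \<Rightarrow> (int \<Rightarrow> real^'n^'n) \<Rightarrow> real \<Rightarrow> bool" where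
  "backward_exponent \<omega> A c \<longleftrightarrow>
     (\<exists>K\<ge>1. \<forall>k n. k \<le> n \<longrightarrow> opnorm (evolution A k n) \<le> K * (\<omega> k / \<omega> n) powr c)"

lemma growth_rate_pos: "growth_rate \<omega> \<Longrightarrow> 0 < \<omega> k"
  by (simp add: growth_rate_def)

section \<open>Operator norm of matrices\<close>

lemma opnorm_nonneg: "0 \<le> opnorm M"
  by (rule onorm_pos_le) (rule matrix_vector_mul_bounded_linear)

lemma opnorm_mult_le: "opnorm (M ** N) \<le> opnorm M * opnorm N"
  using onorm_compose[of "(*v) M" "(*v) N"] matrix_vector_mul_bounded_linear
  by (simp add: matrix_vector_mul_assoc o_def)

lemma opnorm_scaleR: "opnorm (c *\<^sub>R M) = \<bar>c\<bar> * opnorm M"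
  using onorm_scaleR[of "(*v) M" c] matrix_vector_mul_bounded_linear
  by (simp add: scaleR_matrix_vector_assoc)

lemma opnorm_zero: "opnorm 0 = 0"
  using opnorm_scaleR[of 0 0] by simp

lemma opnorm_eq_0_imp: "opnorm M = 0 \<Longrightarrow> M = 0"
  using onorm_eq_0[of "(*v) M"] matrix_vector_mul_bounded_linear
  by (simp add: matrix_eq)

lemma eq_0_of_opnorm_le_tendsto_0:
  assumes "\<forall>\<^sub>F k in F. opnorm M \<le> f k" "(f \<longlongrightarrow> 0) F" "F \<noteq> bot"
  shows "M = 0"
proof -
  have "opnorm M \<le> 0"
    using tendsto_lowerbound[OF assms(2,1,3)] .
  then show ?thesis
    using opnorm_nonneg[of M] by (intro opnorm_eq_0_imp) simp
qed

section \<open>The evolution operator and its weighted versions\<close>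

lemma matrix_inv_inverse:
  fixes M :: "real^'n^'n"
  assumes "invertible M"
  shows "M ** matrix_inv M = mat 1" "matrix_inv M ** M = mat 1"
  using someI_ex[OF assms[unfolded invertible_def]] by (simp_all add: matrix_inv_def)

lemma matrix_inv_scaleR:
  fixes M :: "real^'n^'n"
  assumes "invertible M" "c \<noteq> 0"
  shows "matrix_inv (c *\<^sub>R M) = (1 / c) *\<^sub>R matrix_inv M"
proof -
  let ?N = "matrix_inv (c *\<^sub>R M)"
  have "invertible (c *\<^sub>R M)"
    using assms by (simp add: scalar_invertible)
  then have "M ** (c *\<^sub>R ?N) = mat 1"
    using matrix_inv_inverse(1)[of "c *\<^sub>R M"]
    by (simp add: matrix_scalar_ac flip: scalar_matrix_assoc)
  then have "c *\<^sub>R ?N = matrix_inv M"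
    using matrix_inv_inverse(2)[OF assms(1)]
    by (metis matrix_mul_assoc matrix_mul_lid matrix_mul_rid)
  then have "(1 / c) *\<^sub>R (c *\<^sub>R ?N) = (1 / c) *\<^sub>R matrix_inv M"
    by simp
  then show ?thesis
    using \<open>c \<noteq> 0\<close> by simp
qed

lemma evol_fwd_Suc_right: "evol_fwd A n (Suc j) = evol_fwd A (n + 1) j ** A n"
proof (induction j)
  case (Suc j)
  have shift: "n + int (Suc j) = n + 1 + int j"
    by simp
  have "evol_fwd A n (Suc (Suc j)) = A (n + 1 + int j) ** evol_fwd A n (Suc j)"
    unfolding evol_fwd.simps(2)[of A n "Suc j"] shift ..
  also have "\<dots> = (A (n + 1 + int j) ** evol_fwd A (n + 1) j) ** A n"
    by (simp only: Suc.IH matrix_mul_assoc)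
  finally show ?case
    by (simp only: evol_fwd.simps(2))
qed simp

lemma evol_fwd_bwd_inverse:
  fixes A :: "int \<Rightarrow> real^'n^'n"
  assumes "\<forall>k. invertible (A k)"
  shows "evol_fwd A (n - int j) j ** evol_bwd A n j = mat 1"
proof (induction j)
  case (Suc j)
  have shift: "n - int (Suc j) + 1 = n - int j" by simp
  have "evol_fwd A (n - int (Suc j)) (Suc j) ** evol_bwd A n (Suc j)
      = evol_fwd A (n - int j) j
        ** (A (n - int (Suc j)) ** matrix_inv (A (n - int (Suc j)))) ** evol_bwd A n j"
    unfolding evol_fwd_Suc_right shift evol_bwd.simps by (simp add: matrix_mul_assoc)
  then show ?case
    using Suc by (simp add: matrix_inv_inverse(1)[OF assms[rule_format]])
qed simp

lemma evolution_inverse: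
  fixes A :: "int \<Rightarrow> real^'n^'n"
  assumes "\<forall>k. invertible (A k)"
  shows "evolution A n k ** evolution A k n = mat 1"
proof (cases "n \<le> k")
  case True
  then have "evolution A k n ** evolution A n k = mat 1"
    using evol_fwd_bwd_inverse[OF assms, of k "nat (k - n)"] by (auto simp: evolution_def)
  then show ?thesis
    by (rule matrix_left_right_inverse1)
next
  case False
  then show ?thesis
    using evol_fwd_bwd_inverse[OF assms, of n "nat (n - k)"] by (simp add: evolution_def)
qed

text \<open>The scalar weights telescope along the products, in both time directions.\<close>

lemma evolution_weighted:
  fixes A :: "int \<Rightarrow> real^'n^'n"
  assumes inv: "\<forall>k. invertible (A k)" and \<omega>: "growth_rate \<omega>"
  shows "evolution (weighted \<omega> \<gamma> A) k n = (\<omega> k / \<omega> n) powr (- \<gamma>) *\<^sub>R evolution A k n"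
proof (cases "n \<le> k")
  case True
  note pos = growth_rate_pos[OF \<omega>]
  have "evol_fwd (weighted \<omega> \<gamma> A) n j
      = (\<omega> (n + int j) / \<omega> n) powr (- \<gamma>) *\<^sub>R evol_fwd A n j" for j
  proof (induction j)
    case 0
    then show ?case using growth_rate_pos[OF \<omega>, of n] by simp
  next
    case (Suc j)
    have "(\<omega> (n + int j + 1) / \<omega> (n + int j)) powr (- \<gamma>) * (\<omega> (n + int j) / \<omega> n) powr (- \<gamma>)
        = (\<omega> (n + int (Suc j)) / \<omega> n) powr (- \<gamma>)"
      using pos[of "n + int j"] by (simp add: less_imp_le[OF pos] add_ac flip: powr_mult)
    then show ?case
      by (simp add: Suc weighted_def[of _ _ A "n + int j"] matrix_scalar_ac mult_ac flip: scalar_matrix_assoc)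
  qed
  from this[of "nat (k - n)"] show ?thesis
    using True by (simp add: evolution_def)
next
  case False
  note pos = growth_rate_pos[OF \<omega>]
  have "evol_bwd (weighted \<omega> \<gamma> A) n j
      = (\<omega> (n - int j) / \<omega> n) powr (- \<gamma>) *\<^sub>R evol_bwd A n j" for j
  proof (induction j)
    case 0
    then show ?case using growth_rate_pos[OF \<omega>, of n] by simp
  next
    case (Suc j)
    define m where "m = n - int (Suc j)"
    have m: "n - int j = m + 1" by (simp add: m_def)
    have ne: "(\<omega> (m + 1) / \<omega> m) powr (- \<gamma>) \<noteq> 0"
      using pos[of m] pos[of "m + 1"] by simp
    have "1 / (\<omega> (m + 1) / \<omega> m) powr (- \<gamma>) * (\<omega> (m + 1) / \<omega> n) powr (- \<gamma>)
        = (\<omega> m / \<omega> n) powr (- \<gamma>)"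
      using pos[of "m + 1"] pos[of m] pos[of n] by (simp add: powr_divide)
    then show ?case
      unfolding evol_bwd.simps m_def[symmetric] Suc[unfolded m] weighted_def[of _ _ A m]
      by (simp add: matrix_inv_scaleR[OF inv[rule_format] ne] matrix_scalar_ac mult_ac
          flip: scalar_matrix_assoc)
  qed
  from this[of "nat (n - k)"] show ?thesis
    using False by (simp add: evolution_def)
qed

section \<open>Dichotomies with trivial projector as growth bounds\<close>

lemma scaled_powr_le_iff:
  fixes r :: real
  assumes "0 < r"
  shows "r powr (- \<gamma>) * x \<le> K * r powr \<alpha> \<longleftrightarrow> x \<le> K * r powr (\<alpha> + \<gamma>)"
proof -
  have "r powr \<alpha> = r powr (- \<gamma>) * r powr (\<alpha> + \<gamma>)"
    by (simp flip: powr_add)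
  then have "r powr (- \<gamma>) * x \<le> K * r powr \<alpha>
      \<longleftrightarrow> r powr (- \<gamma>) * x \<le> r powr (- \<gamma>) * (K * r powr (\<alpha> + \<gamma>))"
    by (simp add: mult_ac)
  also have "\<dots> \<longleftrightarrow> x \<le> K * r powr (\<alpha> + \<gamma>)"
    using assms by (subst mult_le_cancel_left_pos) simp_all
  finally show ?thesis .
qed

text \<open>The weight only shifts exponents: multiplying by \<open>(\<omega>(k)/\<omega>(n))\<^sup>\<gamma>\<close> turns the signs
  \<open>\<alpha> < 0 < \<beta>\<close> into \<open>c < \<gamma> < d\<close> for bounds on the original system, which makes different
  weights comparable.\<close>

lemma dichotomy_with_weighted_iff:
  fixes A :: "int \<Rightarrow> real^'n^'n"
  assumes inv: "\<forall>k. invertible (A k)" and \<omega>: "growth_rate \<omega>"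
  shows "dichotomy_with \<omega> (weighted \<omega> \<gamma> A) P \<longleftrightarrow>
    invariant_projector (weighted \<omega> \<gamma> A) P \<and>
    (\<exists>K c d. 1 \<le> K \<and> c < \<gamma> \<and> \<gamma> < d \<and>
      (\<forall>k n. n \<le> k \<longrightarrow> opnorm (evolution A k n ** P n) \<le> K * (\<omega> k / \<omega> n) powr c) \<and>
      (\<forall>k n. k \<le> n \<longrightarrow> opnorm (evolution A k n ** (mat 1 - P n)) \<le> K * (\<omega> k / \<omega> n) powr d))"
    (is "?L \<longleftrightarrow> ?I \<and> (\<exists>K c d. ?R K c d)")
proof -
  have shift: "opnorm (evolution (weighted \<omega> \<gamma> A) k n ** Q) \<le> K * (\<omega> k / \<omega> n) powr \<alpha>
      \<longleftrightarrow> opnorm (evolution A k n ** Q) \<le> K * (\<omega> k / \<omega> n) powr (\<alpha> + \<gamma>)" for k n Q K \<alpha>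
    using scaled_powr_le_iff[of "\<omega> k / \<omega> n"] growth_rate_pos[OF \<omega>]
    by (simp add: evolution_weighted[OF inv \<omega>] opnorm_scaleR flip: scalar_matrix_assoc)
  have L: "?L \<longleftrightarrow> ?I \<and> (\<exists>K \<alpha> \<beta>. \<alpha> < 0 \<and> 0 < \<beta> \<and> ?R K (\<alpha> + \<gamma>) (\<beta> + \<gamma>))"
    unfolding dichotomy_with_def shift by auto
  show ?thesis
    unfolding L
  proof (intro conj_cong iffI refl; elim exE)
    fix K c d assume "?R K c d"
    then show "\<exists>K \<alpha> \<beta>. \<alpha> < 0 \<and> 0 < \<beta> \<and> ?R K (\<alpha> + \<gamma>) (\<beta> + \<gamma>)"
      by (intro exI[of _ K] exI[of _ "c - \<gamma>"] exI[of _ "d - \<gamma>"]) simp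
  qed blast
qed

lemma dichotomy_with_id_iff:
  fixes A :: "int \<Rightarrow> real^'n^'n"
  assumes inv: "\<forall>k. invertible (A k)" and \<omega>: "growth_rate \<omega>"
  shows "dichotomy_with \<omega> (weighted \<omega> \<gamma> A) (\<lambda>_. mat 1) \<longleftrightarrow> (\<exists>c<\<gamma>. forward_exponent \<omega> A c)"
    (is "?L \<longleftrightarrow> ?R")
proof
  assume ?L
  then show ?R
    unfolding dichotomy_with_weighted_iff[OF inv \<omega>] forward_exponent_def matrix_mul_rid by blast
next
  assume ?R
  then obtain c K where "c < \<gamma>" "1 \<le> K"
    and K: "\<forall>k n. n \<le> k \<longrightarrow> opnorm (evolution A k n) \<le> K * (\<omega> k / \<omega> n) powr c"
    unfolding forward_exponent_def by blast
  then show ?L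
    unfolding dichotomy_with_weighted_iff[OF inv \<omega>]
    \<comment> \<open>The complementary projector is zero, so any second exponent above \<open>\<gamma>\<close> will do.\<close>
    by (intro conjI exI[of _ K] exI[of _ c] exI[of _ "\<gamma> + 1"])
       (simp_all add: invariant_projector_def opnorm_zero)
qed

lemma dichotomy_with_zero_iff:
  fixes A :: "int \<Rightarrow> real^'n^'n"
  assumes inv: "\<forall>k. invertible (A k)" and \<omega>: "growth_rate \<omega>"
  shows "dichotomy_with \<omega> (weighted \<omega> \<gamma> A) (\<lambda>_. 0) \<longleftrightarrow> (\<exists>d>\<gamma>. backward_exponent \<omega> A d)"
    (is "?L \<longleftrightarrow> ?R")
proof
  assume ?L
  then show ?R
    unfolding dichotomy_with_weighted_iff[OF inv \<omega>] backward_exponent_def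
      matrix_mul_rid diff_0_right by blast
next
  assume ?R
  then obtain d K where "\<gamma> < d" "1 \<le> K"
    and K: "\<forall>k n. k \<le> n \<longrightarrow> opnorm (evolution A k n) \<le> K * (\<omega> k / \<omega> n) powr d"
    unfolding backward_exponent_def by blast
  then show ?L
    unfolding dichotomy_with_weighted_iff[OF inv \<omega>]
    \<comment> \<open>The projector is zero, so any first exponent below \<open>\<gamma>\<close> will do.\<close>
    by (intro conjI exI[of _ K] exI[of _ "\<gamma> - 1"] exI[of _ d])
       (simp_all add: invariant_projector_def opnorm_zero)
qed

section \<open>Passing to a weakly faster growth rate\<close>

lemma forward_exponent_mono:
  assumes \<omega>: "growth_rate \<omega>" and c: "forward_exponent \<omega> A c" and "c \<le> c'"
  shows "forward_exponent \<omega> A c'"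
proof -
  obtain K where "1 \<le> K"
    and K: "\<And>k n. n \<le> k \<Longrightarrow> opnorm (evolution A k n) \<le> K * (\<omega> k / \<omega> n) powr c"
    using c unfolding forward_exponent_def by blast
  have "opnorm (evolution A k n) \<le> K * (\<omega> k / \<omega> n) powr c'" if "n \<le> k" for k n
  proof -
    have "1 \<le> \<omega> k / \<omega> n"
      using \<omega> that by (simp add: growth_rate_def monoD)
    then have "K * (\<omega> k / \<omega> n) powr c \<le> K * (\<omega> k / \<omega> n) powr c'"
      using \<open>c \<le> c'\<close> \<open>1 \<le> K\<close> by (intro mult_left_mono powr_mono) simp_all
    then show ?thesis
      using K[OF that] by linarith
  qed
  then show ?thesis
    unfolding forward_exponent_def using \<open>1 \<le> K\<close> by blast
qed

lemma backward_exponent_antimono: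
  assumes \<omega>: "growth_rate \<omega>" and d: "backward_exponent \<omega> A d" and "d' \<le> d"
  shows "backward_exponent \<omega> A d'"
proof -
  obtain K where "1 \<le> K"
    and K: "\<And>k n. k \<le> n \<Longrightarrow> opnorm (evolution A k n) \<le> K * (\<omega> k / \<omega> n) powr d"
    using d unfolding backward_exponent_def by blast
  have "opnorm (evolution A k n) \<le> K * (\<omega> k / \<omega> n) powr d'" if "k \<le> n" for k n
  proof -
    have "0 \<le> \<omega> k / \<omega> n" "\<omega> k / \<omega> n \<le> 1"
      using \<omega> that by (simp_all add: growth_rate_def monoD less_imp_le)
    then have "K * (\<omega> k / \<omega> n) powr d \<le> K * (\<omega> k / \<omega> n) powr d'"
      using \<open>d' \<le> d\<close> \<open>1 \<le> K\<close> by (intro mult_left_mono powr_mono') simp_all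
    then show ?thesis
      using K[OF that] by linarith
  qed
  then show ?thesis
    unfolding backward_exponent_def using \<open>1 \<le> K\<close> by blast
qed

lemma weakly_faster_powr_le:
  assumes \<mu>: "growth_rate \<mu>" and \<omega>: "growth_rate \<omega>" and wf: "weakly_faster \<mu> \<omega>" and "0 < c"
  obtains M where "1 \<le> M" "\<And>k n. n \<le> k \<Longrightarrow> (\<omega> k / \<omega> n) powr c \<le> M * (\<mu> k / \<mu> n) powr c"
proof -
  obtain M where "1 \<le> M"
    and M: "\<And>k n. n \<le> k \<Longrightarrow> (\<mu> k / \<mu> n) powr (- c) \<le> M * (\<omega> k / \<omega> n) powr (- c)"
    using wf \<open>0 < c\<close> unfolding weakly_faster_def by (metis neg_less_0_iff_less)
  have "(\<omega> k / \<omega> n) powr c \<le> M * (\<mu> k / \<mu> n) powr c" if "n \<le> k" for k n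
  proof -
    have "0 < (\<mu> k / \<mu> n) powr c" "0 < (\<omega> k / \<omega> n) powr c"
      using \<mu>[unfolded growth_rate_def] \<omega>[unfolded growth_rate_def]
      by (metis divide_pos_pos less_irrefl powr_gt_zero)+
    then show ?thesis
      using M[OF that] by (simp add: powr_minus field_simps)
  qed
  with \<open>1 \<le> M\<close> show thesis by (rule that)
qed

text \<open>Up to a constant, \<open>\<mu>\<close> grows at least as much as \<open>\<omega>\<close>. Replacing \<open>\<omega>\<close> by \<open>\<mu>\<close> therefore weakens
  the growth bound if \<open>c > 0\<close>; for \<open>c < 0\<close> it would strengthen it.\<close>

lemma forward_exponent_weakly_faster:
  assumes "growth_rate \<mu>" "growth_rate \<omega>" "weakly_faster \<mu> \<omega>" "0 < c"
    and c: "forward_exponent \<omega> A c"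
  shows "forward_exponent \<mu> A c"
proof -
  obtain K where "1 \<le> K"
    and K: "\<And>k n. n \<le> k \<Longrightarrow> opnorm (evolution A k n) \<le> K * (\<omega> k / \<omega> n) powr c"
    using c unfolding forward_exponent_def by blast
  obtain M where "1 \<le> M"
    and M: "\<And>k n. n \<le> k \<Longrightarrow> (\<omega> k / \<omega> n) powr c \<le> M * (\<mu> k / \<mu> n) powr c"
    using weakly_faster_powr_le[OF assms(1-4)] by blast
  have "opnorm (evolution A k n) \<le> (K * M) * (\<mu> k / \<mu> n) powr c" if "n \<le> k" for k n
    using order_trans[OF K[OF that] mult_left_mono[OF M[OF that], of K]] \<open>1 \<le> K\<close>
    by (simp add: mult_ac)
  moreover have "1 \<le> K * M"
    using mult_mono[of 1 K 1 M] \<open>1 \<le> K\<close> \<open>1 \<le> M\<close> by simp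
  ultimately show ?thesis
    unfolding forward_exponent_def by blast
qed

lemma backward_exponent_weakly_faster:
  assumes "growth_rate \<mu>" "growth_rate \<omega>" "weakly_faster \<mu> \<omega>" "d < 0"
    and d: "backward_exponent \<omega> A d"
  shows "backward_exponent \<mu> A d"
proof -
  obtain K where "1 \<le> K"
    and K: "\<And>k n. k \<le> n \<Longrightarrow> opnorm (evolution A k n) \<le> K * (\<omega> k / \<omega> n) powr d"
    using d unfolding backward_exponent_def by blast
  obtain M where "1 \<le> M"
    and M: "\<And>k n. k \<le> n \<Longrightarrow> (\<omega> n / \<omega> k) powr (- d) \<le> M * (\<mu> n / \<mu> k) powr (- d)"
    using weakly_faster_powr_le[OF assms(1-3), of "- d"] \<open>d < 0\<close> by (metis neg_0_less_iff_less)
  have flip: "(f n / f k) powr (- d) = (f k / f n) powr d" if "growth_rate f" for f k n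
    using that powr_minus[of "f n / f k" d] powr_divide[of 1 "f n / f k" d]
    by (simp add: growth_rate_def less_imp_le inverse_eq_divide)
  have "opnorm (evolution A k n) \<le> (K * M) * (\<mu> k / \<mu> n) powr d" if "k \<le> n" for k n
    using order_trans[OF K[OF that] mult_left_mono[OF M[OF that, unfolded flip[OF assms(1)]
            flip[OF assms(2)]], of K]] \<open>1 \<le> K\<close>
    by (simp add: mult_ac)
  moreover have "1 \<le> K * M"
    using mult_mono[of 1 K 1 M] \<open>1 \<le> K\<close> \<open>1 \<le> M\<close> by simp
  ultimately show ?thesis
    unfolding backward_exponent_def by blast
qed

section \<open>Constancy of the projector beyond the spectrum\<close>

lemma growth_rate_powr_at_bot:
  assumes "growth_rate \<omega>" "0 < e"
  shows "((\<lambda>k. (\<omega> k / \<omega> n) powr e) \<longlongrightarrow> 0) at_bot"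
proof (rule tendsto_zero_powrI[OF _ tendsto_const])
  have "((\<lambda>k. \<omega> k / \<omega> n) \<longlongrightarrow> 0 / \<omega> n) at_bot"
    using assms by (intro tendsto_divide tendsto_const)
      (auto simp: growth_rate_def order_less_imp_not_eq2)
  then show "((\<lambda>k. \<omega> k / \<omega> n) \<longlongrightarrow> 0) at_bot" by simp
qed (use assms in \<open>simp_all add: growth_rate_def less_imp_le\<close>)

lemma growth_rate_powr_at_top:
  assumes "growth_rate \<omega>" "e < 0"
  shows "((\<lambda>k. (\<omega> k / \<omega> n) powr e) \<longlongrightarrow> 0) at_top"
proof (rule tendsto_neg_powr[OF \<open>e < 0\<close>])
  have "filterlim (\<lambda>k. inverse (\<omega> n) * \<omega> k) at_top at_top"
    using assms by (intro filterlim_tendsto_pos_mult_at_top[OF tendsto_const])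
      (auto simp: growth_rate_def)
  then show "filterlim (\<lambda>k. \<omega> k / \<omega> n) at_top at_top"
    by (simp add: field_simps)
qed

text \<open>Insert \<open>Q = \<Phi>(n,k) \<Phi>(k,n) Q\<close>. If the way out contracts at a better rate than the way back may
  expand, then letting \<open>k\<close> tend to \<open>-\<infinity>\<close> (when \<open>d > c\<close>) or \<open>+\<infinity>\<close> (when \<open>d < c\<close>) forces \<open>Q = 0\<close>.\<close>

lemma opnorm_le_return:
  fixes A :: "int \<Rightarrow> real^'n^'n"
  assumes inv: "\<forall>k. invertible (A k)" and \<omega>: "growth_rate \<omega>" and "0 \<le> K"
    and out: "opnorm (evolution A k n ** Q) \<le> K * (\<omega> k / \<omega> n) powr d"
    and return: "opnorm (evolution A n k) \<le> L * (\<omega> n / \<omega> k) powr c"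
  shows "opnorm Q \<le> (L * K) * (\<omega> k / \<omega> n) powr (d - c)"
proof -
  have "Q = evolution A n k ** (evolution A k n ** Q)"
    by (simp add: matrix_mul_assoc evolution_inverse[OF inv])
  then have "opnorm Q \<le> opnorm (evolution A n k) * opnorm (evolution A k n ** Q)"
    by (metis opnorm_mult_le)
  also have "\<dots> \<le> (L * (\<omega> n / \<omega> k) powr c) * (K * (\<omega> k / \<omega> n) powr d)"
    by (rule mult_mono[OF return out order_trans[OF opnorm_nonneg return] opnorm_nonneg])
  also have "(\<omega> n / \<omega> k) powr c = (\<omega> k / \<omega> n) powr (- c)"
    using powr_divide[of 1 "\<omega> k / \<omega> n" c] growth_rate_pos[OF \<omega>]
    by (simp add: powr_minus less_imp_le inverse_eq_divide)
  finally show ?thesis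
    by (simp add: powr_diff powr_minus field_simps)
qed

text \<open>An exponent below \<open>\<gamma>\<close> exists because the forward exponents cannot have an infimum \<open>s > b\<close>:
  a dichotomy at \<open>s\<close> itself would have projector \<open>Id\<close>, hence a forward exponent below \<open>s\<close>.\<close>

lemma dichotomy_id_right_of_spectrum:
  fixes A :: "int \<Rightarrow> real^'n^'n"
  assumes inv: "\<forall>k. invertible (A k)" and \<omega>: "growth_rate \<omega>"
    and res: "\<And>\<gamma>. b < \<gamma> \<Longrightarrow> dichotomy \<omega> (weighted \<omega> \<gamma> A)"
    and ex: "\<exists>c. forward_exponent \<omega> A c" and "b < \<gamma>"
  shows "\<exists>c<\<gamma>. forward_exponent \<omega> A c"
proof (rule ccontr)
  define s where "s = Inf {c. forward_exponent \<omega> A c}"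
  assume none: "\<not> ?thesis"
  then have lower: "\<gamma> \<le> c" if "forward_exponent \<omega> A c" for c
    using that not_less by blast
  then have bdd: "bdd_below {c. forward_exponent \<omega> A c}"
    by (intro bdd_belowI[of _ \<gamma>]) simp
  have "\<gamma> \<le> s"
    unfolding s_def using ex lower by (intro cInf_greatest) auto
  then obtain P where P: "dichotomy_with \<omega> (weighted \<omega> s A) P"
    using res[of s] \<open>b < \<gamma>\<close> unfolding dichotomy_def by force
  then obtain K d where "1 \<le> K" "s < d"
    and K: "\<And>k n. k \<le> n \<Longrightarrow>
      opnorm (evolution A k n ** (mat 1 - P n)) \<le> K * (\<omega> k / \<omega> n) powr d"
    unfolding dichotomy_with_weighted_iff[OF inv \<omega>] by blast
  \<comment> \<open>Possible because \<open>d\<close> exceeds the infimum \<open>s\<close>.\<close>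
  then obtain c where "c < d" "forward_exponent \<omega> A c"
    using cInf_lessD[of "{c. forward_exponent \<omega> A c}" d] ex unfolding s_def by auto
  then obtain L where L: "\<And>k n. n \<le> k \<Longrightarrow> opnorm (evolution A k n) \<le> L * (\<omega> k / \<omega> n) powr c"
    unfolding forward_exponent_def by blast
  have K0: "0 \<le> K" using \<open>1 \<le> K\<close> by simp
  have "mat 1 - P n = 0" for n
  proof (rule eq_0_of_opnorm_le_tendsto_0)
    show "\<forall>\<^sub>F k in at_bot. opnorm (mat 1 - P n) \<le> (L * K) * (\<omega> k / \<omega> n) powr (d - c)"
      using eventually_le_at_bot[of n]
      by eventually_elim (rule opnorm_le_return[OF inv \<omega> K0 K L])
    show "((\<lambda>k. (L * K) * (\<omega> k / \<omega> n) powr (d - c)) \<longlongrightarrow> 0) at_bot"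
      using \<open>c < d\<close> by (intro tendsto_mult_right_zero growth_rate_powr_at_bot[OF \<omega>]) simp
  qed simp
  then have "P = (\<lambda>_. mat 1)"
    by (intro ext) (metis eq_iff_diff_eq_0)
  then obtain c' where "c' < s" "forward_exponent \<omega> A c'"
    using P dichotomy_with_id_iff[OF inv \<omega>] by blast
  then show False
    using cInf_lower[OF _ bdd, of c'] by (simp add: s_def)
qed

text \<open>The dual argument, with the supremum of the backward exponents; here it is \<open>P(n)\<close> itself that
  vanishes, by going out to \<open>k \<rightarrow> +\<infinity>\<close> and returning.\<close>

lemma dichotomy_zero_left_of_spectrum:
  fixes A :: "int \<Rightarrow> real^'n^'n"
  assumes inv: "\<forall>k. invertible (A k)" and \<omega>: "growth_rate \<omega>"
    and res: "\<And>\<gamma>. \<gamma> < a \<Longrightarrow> dichotomy \<omega> (weighted \<omega> \<gamma> A)"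
    and ex: "\<exists>d. backward_exponent \<omega> A d" and "\<gamma> < a"
  shows "\<exists>d>\<gamma>. backward_exponent \<omega> A d"
proof (rule ccontr)
  define s where "s = Sup {d. backward_exponent \<omega> A d}"
  assume none: "\<not> ?thesis"
  then have upper: "d \<le> \<gamma>" if "backward_exponent \<omega> A d" for d
    using that not_less by blast
  then have bdd: "bdd_above {d. backward_exponent \<omega> A d}"
    by (intro bdd_aboveI[of _ \<gamma>]) simp
  have "s \<le> \<gamma>"
    unfolding s_def using ex upper by (intro cSup_least) auto
  then obtain P where P: "dichotomy_with \<omega> (weighted \<omega> s A) P"
    using res[of s] \<open>\<gamma> < a\<close> unfolding dichotomy_def by force
  then obtain K c where "1 \<le> K" "c < s"
    and K: "\<And>k n. n \<le> k \<Longrightarrow> opnorm (evolution A k n ** P n) \<le> K * (\<omega> k / \<omega> n) powr c"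
    unfolding dichotomy_with_weighted_iff[OF inv \<omega>] by blast
  \<comment> \<open>Possible because \<open>c\<close> lies below the supremum \<open>s\<close>.\<close>
  then obtain d where "c < d" "backward_exponent \<omega> A d"
    using less_cSupD[of "{d. backward_exponent \<omega> A d}" c] ex unfolding s_def by auto
  then obtain L where L: "\<And>k n. k \<le> n \<Longrightarrow> opnorm (evolution A k n) \<le> L * (\<omega> k / \<omega> n) powr d"
    unfolding backward_exponent_def by blast
  have K0: "0 \<le> K" using \<open>1 \<le> K\<close> by simp
  have "P n = 0" for n
  proof (rule eq_0_of_opnorm_le_tendsto_0)
    show "\<forall>\<^sub>F k in at_top. opnorm (P n) \<le> (L * K) * (\<omega> k / \<omega> n) powr (c - d)"
      using eventually_ge_at_top[of n]
      by eventually_elim (rule opnorm_le_return[OF inv \<omega> K0 K L])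
    show "((\<lambda>k. (L * K) * (\<omega> k / \<omega> n) powr (c - d)) \<longlongrightarrow> 0) at_top"
      using \<open>c < d\<close> by (intro tendsto_mult_right_zero growth_rate_powr_at_top[OF \<omega>]) simp
  qed simp
  then have "P = (\<lambda>_. 0)" by blast
  then obtain d' where "s < d'" "backward_exponent \<omega> A d'"
    using P dichotomy_with_zero_iff[OF inv \<omega>] by blast
  then show False
    using cSup_upper[OF _ bdd, of d'] by (simp add: s_def)
qed

section \<open>Comparison of spectra\<close>

text \<open>Only a finite \<open>b\<close> needs an argument. The hypothesis at \<open>+\<infinity>\<close> starts the projector argument,
  and the point \<open>+\<infinity>\<close> of the spectrum for \<open>\<mu>\<close> is excluded by any finite weight beyond \<open>b\<close>.\<close>

lemma spectrum_pos_weakly_faster: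
  fixes A :: "int \<Rightarrow> real^'n^'n"
  assumes inv: "\<forall>k. invertible (A k)"
    and \<mu>: "growth_rate \<mu>" and \<omega>: "growth_rate \<omega>" and wf: "weakly_faster \<mu> \<omega>"
    and "0 \<le> b" and sub: "spectrum_pos \<omega> A \<subseteq> {0..b}"
  shows "spectrum_pos \<mu> A \<subseteq> {0..b}"
proof (cases b)
  case (real r)
  have "0 \<le> r" using \<open>0 \<le> b\<close> real by simp
  have resolvent: "weighted_dichotomy \<omega> A x" if "b < x" for x
  proof (rule ccontr)
    assume "\<not> weighted_dichotomy \<omega> A x"
    then have "x \<in> spectrum_pos \<omega> A"
      using that \<open>0 \<le> b\<close> by (auto simp: spectrum_pos_def spectrum_def)
    then have "x \<in> {0..b}" using sub by blast
    with that show False by (metis atLeastAtMost_iff leD)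
  qed
  have "b < PInfty"
    using real by simp
  then have "\<exists>c. forward_exponent \<omega> A c"
    using resolvent dichotomy_with_id_iff[OF inv \<omega>]
    by (metis weighted_dichotomy.simps(2))
  moreover have "dichotomy \<omega> (weighted \<omega> \<gamma> A)" if "r < \<gamma>" for \<gamma>
    using resolvent[of "ereal \<gamma>"] real that by simp
  ultimately have \<omega>_exp: "\<exists>c<\<gamma>. forward_exponent \<omega> A c" if "r < \<gamma>" for \<gamma>
    using dichotomy_id_right_of_spectrum[OF inv \<omega>] that by blast
  have \<mu>_dich: "dichotomy_with \<mu> (weighted \<mu> \<gamma> A) (\<lambda>_. mat 1)" if "r < \<gamma>" for \<gamma>
  proof -
    obtain c where "c < \<gamma>" and c: "forward_exponent \<omega> A c"
      using \<omega>_exp[of \<gamma>] \<open>r < \<gamma>\<close> by blast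
    \<comment> \<open>Raise the exponent to a positive one still below \<open>\<gamma>\<close>; possible since \<open>\<gamma> > r \<ge> 0\<close>.\<close>
    have "forward_exponent \<omega> A (max c (\<gamma> / 2))"
      by (rule forward_exponent_mono[OF \<omega> c]) simp
    then have "forward_exponent \<mu> A (max c (\<gamma> / 2))"
      using \<open>0 \<le> r\<close> that by (intro forward_exponent_weakly_faster[OF \<mu> \<omega> wf]) simp_all
    moreover have "max c (\<gamma> / 2) < \<gamma>"
      using \<open>c < \<gamma>\<close> \<open>0 \<le> r\<close> that by simp
    ultimately show ?thesis
      unfolding dichotomy_with_id_iff[OF inv \<mu>] by blast
  qed
  have "weighted_dichotomy \<mu> A x" if "b < x" for x
  proof (cases x)
    case (real \<gamma>)
    then show ?thesis
      using \<mu>_dich[of \<gamma>] that \<open>b = ereal r\<close> by (auto simp: dichotomy_def)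
  next
    case PInf
    have "weighted_dichotomy \<mu> A PInfty"
      unfolding weighted_dichotomy.simps using \<mu>_dich[of "r + 1"] by auto
    with PInf show ?thesis by simp
  qed (use that in simp)
  then show ?thesis
    by (force simp: spectrum_pos_def spectrum_def not_less[symmetric])
qed (use \<open>0 \<le> b\<close> in \<open>auto simp: spectrum_pos_def\<close>)

lemma spectrum_neg_weakly_faster:
  fixes A :: "int \<Rightarrow> real^'n^'n"
  assumes inv: "\<forall>k. invertible (A k)"
    and \<mu>: "growth_rate \<mu>" and \<omega>: "growth_rate \<omega>" and wf: "weakly_faster \<mu> \<omega>"
    and "a \<le> 0" and sub: "spectrum_neg \<omega> A \<subseteq> {a..0}"
  shows "spectrum_neg \<mu> A \<subseteq> {a..0}"
proof (cases a)
  case (real r)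
  have "r \<le> 0" using \<open>a \<le> 0\<close> real by simp
  have resolvent: "weighted_dichotomy \<omega> A x" if "x < a" for x
  proof (rule ccontr)
    assume "\<not> weighted_dichotomy \<omega> A x"
    then have "x \<in> spectrum_neg \<omega> A"
      using that \<open>a \<le> 0\<close> by (auto simp: spectrum_neg_def spectrum_def)
    then have "x \<in> {a..0}" using sub by blast
    with that show False by (metis atLeastAtMost_iff leD)
  qed
  have "MInfty < a"
    using real by simp
  then have "\<exists>d. backward_exponent \<omega> A d"
    using resolvent dichotomy_with_zero_iff[OF inv \<omega>]
    by (metis weighted_dichotomy.simps(3))
  moreover have "dichotomy \<omega> (weighted \<omega> \<gamma> A)" if "\<gamma> < r" for \<gamma>
    using resolvent[of "ereal \<gamma>"] real that by simp
  ultimately have \<omega>_exp: "\<exists>d>\<gamma>. backward_exponent \<omega> A d" if "\<gamma> < r" for \<gamma>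
    using dichotomy_zero_left_of_spectrum[OF inv \<omega>] that by blast
  have \<mu>_dich: "dichotomy_with \<mu> (weighted \<mu> \<gamma> A) (\<lambda>_. 0)" if "\<gamma> < r" for \<gamma>
  proof -
    obtain d where "\<gamma> < d" and d: "backward_exponent \<omega> A d"
      using \<omega>_exp[of \<gamma>] \<open>\<gamma> < r\<close> by blast
    \<comment> \<open>Lower the exponent to a negative one still above \<open>\<gamma>\<close>; possible since \<open>\<gamma> < r \<le> 0\<close>.\<close>
    have "backward_exponent \<omega> A (min d (\<gamma> / 2))"
      by (rule backward_exponent_antimono[OF \<omega> d]) simp
    then have "backward_exponent \<mu> A (min d (\<gamma> / 2))"
      using \<open>r \<le> 0\<close> that by (intro backward_exponent_weakly_faster[OF \<mu> \<omega> wf]) simp_all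
    moreover have "\<gamma> < min d (\<gamma> / 2)"
      using \<open>\<gamma> < d\<close> \<open>r \<le> 0\<close> that by simp
    ultimately show ?thesis
      unfolding dichotomy_with_zero_iff[OF inv \<mu>] by blast
  qed
  have "weighted_dichotomy \<mu> A x" if "x < a" for x
  proof (cases x)
    case (real \<gamma>)
    then show ?thesis
      using \<mu>_dich[of \<gamma>] that \<open>a = ereal r\<close> by (auto simp: dichotomy_def)
  next
    case MInf
    have "weighted_dichotomy \<mu> A MInfty"
      unfolding weighted_dichotomy.simps using \<mu>_dich[of "r - 1"] by auto
    with MInf show ?thesis by simp
  qed (use that in simp)
  then show ?thesis
    by (force simp: spectrum_neg_def spectrum_def not_less[symmetric])
qed (use \<open>a \<le> 0\<close> in \<open>auto simp: spectrum_neg_def\<close>)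

theorem theorem4p5:
  fixes A :: "int \<Rightarrow> real^'n^'n" and \<mu> \<omega> :: "int \<Rightarrow> real" and a b :: ereal
  assumes "\<And>k. invertible (A k)"
    and "growth_rate \<mu>" and "growth_rate \<omega>"
    and "weakly_faster \<mu> \<omega>"
    and "a \<le> 0" and "0 \<le> b"
  shows "(spectrum_pos \<omega> A \<subseteq> {0..b} \<longrightarrow> spectrum_pos \<mu> A \<subseteq> {0..b})
       \<and> (spectrum_neg \<omega> A \<subseteq> {a..0} \<longrightarrow> spectrum_neg \<mu> A \<subseteq> {a..0})
       \<and> (spectrum \<omega> A \<subseteq> {a..b} \<longrightarrow> spectrum \<mu> A \<subseteq> {a..b})"
proof -
  have inv: "\<forall>k. invertible (A k)" using assms(1) by blast
  have i: "spectrum_pos \<mu> A \<subseteq> {0..b}" if "spectrum_pos \<omega> A \<subseteq> {0..b}"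
    using spectrum_pos_weakly_faster[OF inv assms(2-4,6) that] .
  have ii: "spectrum_neg \<mu> A \<subseteq> {a..0}" if "spectrum_neg \<omega> A \<subseteq> {a..0}"
    using spectrum_neg_weakly_faster[OF inv assms(2-5) that] .
  have "spectrum \<mu> A \<subseteq> {a..b}" if sub: "spectrum \<omega> A \<subseteq> {a..b}"
  proof -
    have "spectrum_pos \<omega> A \<subseteq> {0..b}" "spectrum_neg \<omega> A \<subseteq> {a..0}"
      using sub by (auto simp: spectrum_pos_def spectrum_neg_def)
    then have "spectrum_pos \<mu> A \<union> spectrum_neg \<mu> A \<subseteq> {a..b}"
      using i ii \<open>a \<le> 0\<close> \<open>0 \<le> b\<close> by fastforce
    moreover have "spectrum \<mu> A = spectrum_pos \<mu> A \<union> spectrum_neg \<mu> A"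
      by (auto simp: spectrum_pos_def spectrum_neg_def)
    ultimately show ?thesis by simp
  qed
  with i ii show ?thesis by blast
qed

end
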